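(* A minimal generating set of $ESL_2(\mathbb{Z})$ is $S=\{t_{12},\rho\}$, where $$t_{12}=\begin{pmatrix}1&1\\0&1\end{pmatrix},\qquad \rho=\begin{pmatrix}0&1\\1&0\end{pmatrix}.$$
   Context: $ESL_2(\mathbb{Z})$ denotes the group of all $2\times 2$ integer matrices with determinant $1$ or $-1$. A generating set is minimal if no generating set of smaller cardinality exists. *)

theory Defs
  imports
    "HOL-Analysis.Determinants"
    "HOL-Algebra.Generated_Groups"
    "HOL-Library.Equipollence"
begin

definition ESL2Z :: "(int^2^2) monoid" where
  "ESL2Z = \<lparr> carrier = {A. det A = 1 \<or> det A = -1}, mult = (**), one = mat 1 \<rparr>"

definition t12 :: "int^2^2" where
  "t12 = vector [vector [1, 1],
                 vector [0, 1]]"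

definition rho :: "int^2^2" where
  "rho = vector [vector [0, 1],
                 vector [1, 0]]"

definition generating_set :: "('a, 'b) monoid_scheme \<Rightarrow> 'a set \<Rightarrow> bool" where
  "generating_set G S \<longleftrightarrow> S \<subseteq> carrier G \<and> generate G S = carrier G"

(* Minimality refers to cardinality, not to inclusion. Cardinalities are compared with lesspoll
   rather than card because card is 0 on infinite sets. *)
definition minimal_generating_set :: "('a, 'b) monoid_scheme \<Rightarrow> 'a set \<Rightarrow> bool" where
  "minimal_generating_set G S \<longleftrightarrow>
     generating_set G S \<and> \<not> (\<exists>T. generating_set G T \<and> T \<prec> S)"

lemma group_ESL2Z: "group ESL2Z"
proof (rule groupI)
  fix A B assume "A \<in> carrier ESL2Z" "B \<in> carrier ESL2Z"
  then show "A \<otimes>\<^bsub>ESL2Z\<^esub> B \<in> carrier ESL2Z"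
    by (auto simp: ESL2Z_def det_mul)
next
  fix A assume A: "A \<in> carrier ESL2Z"
  define B :: "int^2^2" where
    "B = vector [vector [det A * A$2$2, - det A * A$1$2], vector [- det A * A$2$1, det A * A$1$1]]"
  have sq: "det A * det A = 1"
    using A by (auto simp: ESL2Z_def)
  have "B ** A = mat (det A * det A)"
    by (simp add: B_def vec_eq_iff matrix_matrix_mult_def mat_def forall_2 sum_2 det_2 algebra_simps)
  then have BA: "B ** A = mat 1"
    by (simp add: sq)
  then have "det B * det A = 1"
    by (metis det_I det_mul)
  then have "B \<in> carrier ESL2Z"
    using A by (auto simp: ESL2Z_def)
  then show "\<exists>B\<in>carrier ESL2Z. B \<otimes>\<^bsub>ESL2Z\<^esub> A = \<one>\<^bsub>ESL2Z\<^esub>"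
    using BA by (auto simp: ESL2Z_def)
qed (auto simp: ESL2Z_def matrix_mul_assoc)

end

theory Submission
  imports Defs
begin

text \<open>
  Multiplying a matrix on the left by \<open>t12\<close> to the power \<open>k\<close> adds \<open>k\<close> times the second row to the
  first, and multiplying by \<open>rho\<close> swaps the rows.  These two moves carry out the Euclidean algorithm
  on the first column, so every matrix of determinant \<open>\<plusminus>1\<close> is reduced, within its coset of the
  subgroup generated by \<open>t12\<close> and \<open>rho\<close>, to an upper triangular one
  (\<open>ESL2Z_in_gen\<close>).  Its diagonal entries are \<open>\<plusminus>1\<close>, so it is a shear times a diagonal sign matrix;
  the sign matrices are words in the generators because the rotation by a right angle is a product of
  three elementary shears, and composing it with \<open>rho\<close> gives a reflection in a coordinate axis
  (\<open>reflect_in_gen\<close>).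

  Two is the least possible number of generators because a group generated by at most one element is
  abelian, whereas \<open>t12\<close> and \<open>rho\<close> do not commute.
\<close>

section \<open>Two-by-two integer matrices\<close>

definition mat22 :: "int \<Rightarrow> int \<Rightarrow> int \<Rightarrow> int \<Rightarrow> int^2^2" where
  "mat22 a b c d = vector [vector [a, b], vector [c, d]]"

lemma mat22_mult:
  "mat22 a b c d ** mat22 a' b' c' d' =
     mat22 (a * a' + b * c') (a * b' + b * d') (c * a' + d * c') (c * b' + d * d')"
  by (simp add: mat22_def vec_eq_iff matrix_matrix_mult_def forall_2 sum_2)

lemma mat22_eta: "A = mat22 (A$1$1) (A$1$2) (A$2$1) (A$2$2)"
  by (simp add: mat22_def vec_eq_iff forall_2)

lemma mat22_eq_iff: "mat22 a b c d = mat22 a' b' c' d' \<longleftrightarrow> a = a' \<and> b = b' \<and> c = c' \<and> d = d'"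
  by (auto simp: mat22_def vec_eq_iff forall_2)

lemma det_mat22: "det (mat22 a b c d) = a * d - b * c"
  by (simp add: mat22_def det_2)

lemma mat_1_eq_mat22: "mat 1 = mat22 1 0 0 1"
  by (simp add: mat22_def vec_eq_iff forall_2 mat_def)

lemma t12_eq_mat22: "t12 = mat22 1 1 0 1"
  by (simp add: t12_def mat22_def)

lemma rho_eq_mat22: "rho = mat22 0 1 1 0"
  by (simp add: rho_def mat22_def)

lemma mat22_in_ESL2Z: "mat22 a b c d \<in> carrier ESL2Z \<longleftrightarrow> \<bar>a * d - b * c\<bar> = 1"
  by (auto simp: ESL2Z_def det_mat22)

lemma mult_ESL2Z: "A \<otimes>\<^bsub>ESL2Z\<^esub> B = A ** B"
  by (simp add: ESL2Z_def)

lemma one_ESL2Z: "\<one>\<^bsub>ESL2Z\<^esub> = mat22 1 0 0 1"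
  by (simp add: ESL2Z_def mat_1_eq_mat22)

section \<open>Generation\<close>

abbreviation gen :: "(int^2^2) set" where
  "gen \<equiv> generate ESL2Z {t12, rho}"

lemma generators_in_ESL2Z: "{t12, rho} \<subseteq> carrier ESL2Z"
  by (simp add: t12_eq_mat22 rho_eq_mat22 mat22_in_ESL2Z)

lemma gen_mult: "A \<in> gen \<Longrightarrow> B \<in> gen \<Longrightarrow> A ** B \<in> gen"
  using generate.eng[of A ESL2Z "{t12, rho}" B] by (simp add: mult_ESL2Z)

lemma rho_in_gen: "mat22 0 1 1 0 \<in> gen"
  using generate.incl[of rho "{t12, rho}" ESL2Z] by (simp add: rho_eq_mat22)

lemma shear_in_gen: "mat22 1 k 0 1 \<in> gen"
proof (induction k rule: int_induct[where k = 0])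
  case base
  show ?case
    using generate.one[of ESL2Z] by (simp add: one_ESL2Z)
next
  case (step1 k)
  have "mat22 1 1 0 1 \<in> gen"
    using generate.incl[of t12 "{t12, rho}" ESL2Z] by (simp add: t12_eq_mat22)
  from gen_mult[OF this step1.IH] show ?case
    by (simp add: mat22_mult)
next
  case (step2 k)
  have "inv\<^bsub>ESL2Z\<^esub> t12 = mat22 1 (-1) 0 1"
    by (intro group.inv_equality[OF group_ESL2Z])
       (simp_all add: mult_ESL2Z one_ESL2Z t12_eq_mat22 mat22_mult mat22_in_ESL2Z)
  then have "mat22 1 (-1) 0 1 \<in> gen"
    using generate.inv[of t12 "{t12, rho}" ESL2Z] by simp
  from gen_mult[OF this step2.IH] show ?case
    by (simp add: mat22_mult)
qed

text \<open>
  Conjugating a shear by \<open>rho\<close> transposes it, and the product of an upper, a lower and an upper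
  elementary shear with signs \<open>-\<close>, \<open>+\<close>, \<open>-\<close> is the rotation by a right angle.  One more factor
  \<open>rho\<close> swaps its columns and leaves a diagonal matrix.
\<close>

lemma reflect_in_gen: "mat22 (-1) 0 0 1 \<in> gen"
proof -
  let ?u = "mat22 1 (-1) 0 1" and ?r = "mat22 0 1 1 0"
  have "?u ** ((?r ** (mat22 1 1 0 1 ** ?r)) ** (?u ** ?r)) \<in> gen"
    by (intro gen_mult shear_in_gen rho_in_gen)
  then show ?thesis
    by (simp add: mat22_mult)
qed

lemma diag_signs_in_gen:
  assumes "\<bar>a\<bar> = 1" "\<bar>d\<bar> = 1"
  shows "mat22 a 0 0 d \<in> gen"
proof -
  let ?r = "mat22 0 1 1 0" and ?s = "mat22 (-1) 0 0 1"
  have "?r ** (?s ** ?r) \<in> gen"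
    by (intro gen_mult reflect_in_gen rho_in_gen)
  then have other: "mat22 1 0 0 (-1) \<in> gen"
    by (simp add: mat22_mult)
  have both: "mat22 (-1) 0 0 (-1) \<in> gen"
    using gen_mult[OF reflect_in_gen other] by (simp add: mat22_mult)
  have "(a = 1 \<or> a = -1) \<and> (d = 1 \<or> d = -1)"
    using assms by linarith
  then show ?thesis
    using reflect_in_gen other both shear_in_gen[of 0] by auto
qed

lemma triangular_in_gen:
  assumes "\<bar>a * d\<bar> = 1"
  shows "mat22 a b 0 d \<in> gen"
proof -
  have ad: "\<bar>a\<bar> = 1" "\<bar>d\<bar> = 1"
    using assms by (auto simp: abs_mult zmult_eq_1_iff)
  have dd: "d * d = 1"
    using ad(2) by (metis abs_mult_self_eq mult_1)
  have "mat22 1 (b * d) 0 1 ** mat22 a 0 0 d = mat22 a b 0 d"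
    by (simp add: mat22_mult mult.assoc dd)
  then show ?thesis
    using gen_mult[OF shear_in_gen[of "b * d"] diag_signs_in_gen[OF ad]] by simp
qed

text \<open>
  Each round of the Euclidean algorithm replaces the first column \<open>(a, c)\<close> by \<open>(c, a mod c)\<close>, which
  makes the absolute value of the lower entry smaller; when that entry is zero the matrix is
  triangular.
\<close>

lemma ESL2Z_in_gen: "\<bar>a * d - b * c\<bar> = 1 \<Longrightarrow> mat22 a b c d \<in> gen"
proof (induction "nat \<bar>c\<bar>" arbitrary: a b c d rule: less_induct)
  case less
  show ?case
  proof (cases "c = 0")
    case True
    then show ?thesis
      using less.prems by (simp add: triangular_in_gen)
  next
    case False
    define q where "q = a div c"
    have mod: "a - q * c = a mod c"
      by (simp add: q_def minus_div_mult_eq_mod)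
    have "nat \<bar>a - q * c\<bar> < nat \<bar>c\<bar>"
      using False abs_mod_less[of c a] by (simp add: mod)
    moreover have "\<bar>c * (b - q * d) - d * (a - q * c)\<bar> = 1"
      using less.prems by (simp add: algebra_simps abs_minus_commute)
    ultimately have "mat22 c d (a - q * c) (b - q * d) \<in> gen"
      by (rule less.hyps)
    then have "mat22 1 q 0 1 ** (mat22 0 1 1 0 ** mat22 c d (a - q * c) (b - q * d)) \<in> gen"
      by (intro gen_mult shear_in_gen rho_in_gen)
    then show ?thesis
      by (simp add: mat22_mult)
  qed
qed

lemma generating_set_t12_rho: "generating_set ESL2Z {t12, rho}"
  unfolding generating_set_def
proof (intro conjI subset_antisym)
  show "gen \<subseteq> carrier ESL2Z"
    using group.generate_incl[OF group_ESL2Z generators_in_ESL2Z] .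
  show "carrier ESL2Z \<subseteq> gen"
  proof
    fix A assume "A \<in> carrier ESL2Z"
    then show "A \<in> gen"
      using ESL2Z_in_gen mat22_in_ESL2Z mat22_eta[of A] by metis
  qed
qed (rule generators_in_ESL2Z)

section \<open>Minimality\<close>

lemma (in group) generate_singleton_commute:
  assumes "g \<in> carrier G" "x \<in> generate G {g}" "y \<in> generate G {g}"
  shows "x \<otimes> y = y \<otimes> x"
proof -
  obtain i j :: int where "x = g [^] i" "y = g [^] j"
    using assms generate_pow[OF assms(1)] by auto
  then show ?thesis
    using assms(1) by (simp add: int_pow_mult[symmetric] add.commute)
qed

lemma lesspoll_pair_imp_subset_singleton:
  assumes "T \<prec> {a, b}"
  shows "\<exists>g. T \<subseteq> {g}"
proof -
  have le: "T \<lesssim> {a, b}" and "\<not> {a, b} \<lesssim> T"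
    using assms lepoll_antisym by (auto simp: lesspoll_def)
  from le have fin: "finite T"
    unfolding lepoll_def by (meson finite.emptyI finite.insertI finite_subset finite_imageD)
  have "card T < card {a, b}"
    using \<open>\<not> {a, b} \<lesssim> T\<close> lepoll_iff_card_le[of "{a, b}" T] fin by simp
  also have "\<dots> \<le> 2"
    by (simp add: card_insert_if)
  finally have "card T \<le> Suc 0"
    by simp
  then have "\<forall>x\<in>T. \<forall>y\<in>T. x = y"
    using fin by (simp add: card_le_Suc0_iff_eq)
  then show ?thesis
    by blast
qed

lemma (in group) noncommuting_imp_no_small_generating_set:
  assumes xy: "x \<in> carrier G" "y \<in> carrier G" "x \<otimes> y \<noteq> y \<otimes> x"
    and T: "generating_set G T"
  shows "\<not> T \<prec> {a, b}"
proof
  assume "T \<prec> {a, b}"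
  then obtain g where g: "T \<subseteq> {g}"
    using lesspoll_pair_imp_subset_singleton by metis
  \<comment> \<open>For empty \<open>T\<close> the element \<open>g\<close> is arbitrary and may lie outside the group, so the identity
      replaces it.\<close>
  then obtain h where h: "T \<subseteq> {h}" "h \<in> carrier G"
    using T by (cases "T = {}") (auto simp: generating_set_def)
  have "carrier G \<subseteq> generate G {h}"
    using T mono_generate[OF h(1)] by (simp add: generating_set_def)
  then show False
    using generate_singleton_commute[OF h(2)] xy by blast
qed

theorem proposition3p1:
  shows "minimal_generating_set ESL2Z {t12, rho}"
proof -
  have "t12 \<otimes>\<^bsub>ESL2Z\<^esub> rho \<noteq> rho \<otimes>\<^bsub>ESL2Z\<^esub> t12"
    by (simp add: mult_ESL2Z t12_eq_mat22 rho_eq_mat22 mat22_mult mat22_eq_iff)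
  then have "\<not> T \<prec> {t12, rho}" if "generating_set ESL2Z T" for T
    using group.noncommuting_imp_no_small_generating_set[OF group_ESL2Z _ _ _ that, of t12 rho]
      generators_in_ESL2Z by simp
  then show ?thesis
    using generating_set_t12_rho by (auto simp: minimal_generating_set_def)
qed

end
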